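(* Let $(X,\mathsf d,\mu)$ be a proper metric measure space and let $u,v\in L^1_{\mathrm{loc}}(\Omega,\mu)$ be lower semicontinuous and upper semicontinuous functions respectively in $\overline\Omega\subseteq X$ such that $u\ge v$ on $\partial\Omega$, and either (i) $\underline\Delta{}_\mu^{\mathsf d}u\le0$ and $\underline\Delta{}_\mu^{\mathsf d}v\ge0$ in $\Omega$, or (ii) $\overline\Delta{}_\mu^{\mathsf d}u\le0$ and $\overline\Delta{}_\mu^{\mathsf d}v\ge0$ in $\Omega$. Assume also that there exists a bounded function $\phi$ which is upper semicontinuous in $\overline\Omega$ and such that $\underline\Delta{}_\mu^{\mathsf d}\phi>0$. Then $u\ge v$ in $\overline\Omega$.
   Context: A metric measure space $(X,\mathsf d,\mu)$ is a metric space $(X,\mathsf d)$ with a measure $\mu$ such that $\mu(U)>0$ for every non-empty open $U\subset X$. It is called proper if all closed bounded subsets are compact (in which case any upper semicontinuous function defined on the closure of a bounded domain attains its maximum). Functions may take values in the extended reals $\overline{\mathbb R}$. Convention: a function $u\in L^1_{\mathrm{loc}}$ is evaluated pointwise through its representative whose value at $x$ is $\lim_{r\to0^+}\mu(B_r(x))^{-1}\int_{B_r(x)}u\,d\mu$ whenever this limit exists, where $B_r(x)$ is the ball of center $x$ and radius $r$. For $r>0$ set $$\Delta_{\mu,r}^{\mathsf d}u(x):=\frac1{r^2}\,\frac1{\mu(B_r(x))}\int_{B_r(x)}\big(u(y)-u(x)\big)\,d\mu(y),$$ where, if $u$ is defined only on a subset of $X$, the ball $B_r(x)$ is replaced by its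 intersection with that subset. The upper and lower AMV (asymptotic mean value) Laplacians are $$\overline\Delta{}_\mu^{\mathsf d}u(x):=\limsup_{r\to0^+}\Delta_{\mu,r}^{\mathsf d}u(x),\qquad \underline\Delta{}_\mu^{\mathsf d}u(x):=\liminf_{r\to0^+}\Delta_{\mu,r}^{\mathsf d}u(x).$$ Inequalities "in $\Omega$" are meant at every point of $\Omega$.
   Formalization: Ω is taken to be open and bounded, and the lower semicontinuous u is assumed never −∞ and the upper semicontinuous v never +∞ on the closure of Ω; the claim fails for unbounded Ω and when u = v = ±∞ is allowed at boundary points. *)

theory Defs
  imports "HOL-Analysis.Analysis"
begin

text \<open>
  The underlying metric space is the whole type. The \<open>\<sigma>\<close>-algebra may be larger than the Borel one;
  no local finiteness is imposed.
\<close>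

definition metric_measure_space :: "'a::metric_space measure \<Rightarrow> bool" where
  "metric_measure_space M \<longleftrightarrow>
     space M = UNIV \<and> sets borel \<subseteq> sets M \<and>
     (\<forall>U. open U \<and> U \<noteq> {} \<longrightarrow> emeasure M U > 0)"

text \<open>
  As is customary for extended real-valued functions, an upper semicontinuous function does not take
  the value \<open>\<infinity>\<close> and a lower semicontinuous one does not take the value \<open>-\<infinity>\<close>. The comparison principle
  needs this at boundary points: on the punctured unit disc, \<open>u = 2 ln |x|\<close> and \<open>v = ln |x|\<close> are
  harmonic and extend continuously by \<open>u 0 = v 0 = -\<infinity>\<close>, with \<open>u = v\<close> on the boundary but \<open>u < v\<close>
  inside.
\<close>

definition usc_on :: "'a::topological_space set \<Rightarrow> ('a \<Rightarrow> ereal) \<Rightarrow> bool" where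
  "usc_on S f \<longleftrightarrow>
     (\<forall>x\<in>S. f x < \<infinity> \<and> (\<forall>c. f x < c \<longrightarrow> (\<forall>\<^sub>F y in at x within S. f y < c)))"

definition lsc_on :: "'a::topological_space set \<Rightarrow> ('a \<Rightarrow> ereal) \<Rightarrow> bool" where
  "lsc_on S f \<longleftrightarrow>
     (\<forall>x\<in>S. - \<infinity> < f x \<and> (\<forall>c. c < f x \<longrightarrow> (\<forall>\<^sub>F y in at x within S. c < f y)))"

definition L1_loc :: "'a::topological_space measure \<Rightarrow> 'a set \<Rightarrow> ('a \<Rightarrow> ereal) \<Rightarrow> bool" where
  "L1_loc M S f \<longleftrightarrow>
     f \<in> borel_measurable (restrict_space M S) \<and>
     (\<forall>K. compact K \<and> K \<subseteq> S \<longrightarrow> (\<integral>\<^sup>+y\<in>K. e2ennreal \<bar>f y\<bar> \<partial>M) < \<infinity>)"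

text \<open>
  Integral of an extended real-valued function, as the difference of the integrals of its positive
  and negative parts; \<^const>\<open>e2ennreal\<close> sends negative numbers to \<open>0\<close>. The value is meaningless
  if both parts have infinite integral.
\<close>

definition ereal_integral :: "'a measure \<Rightarrow> 'a set \<Rightarrow> ('a \<Rightarrow> ereal) \<Rightarrow> ereal" where
  "ereal_integral M A f =
     enn2ereal (\<integral>\<^sup>+y\<in>A. e2ennreal (f y) \<partial>M) - enn2ereal (\<integral>\<^sup>+y\<in>A. e2ennreal (- f y) \<partial>M)"

definition ereal_mean :: "'a measure \<Rightarrow> 'a set \<Rightarrow> ('a \<Rightarrow> ereal) \<Rightarrow> ereal" where
  "ereal_mean M A f = ereal_integral M A f / enn2ereal (emeasure M A)"

text \<open>In the following definitions, \<open>D\<close> is the set on which the function is defined.\<close>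

definition precise_on ::
    "'a::metric_space measure \<Rightarrow> 'a set \<Rightarrow> 'a set \<Rightarrow> ('a \<Rightarrow> ereal) \<Rightarrow> bool" where
  "precise_on M D S f \<longleftrightarrow>
     (\<forall>x\<in>S. \<forall>l. ((\<lambda>r. ereal_mean M (ball x r \<inter> D) f) \<longlongrightarrow> l) (at_right 0) \<longrightarrow> f x = l)"

definition amv_quotient ::
    "'a::metric_space measure \<Rightarrow> 'a set \<Rightarrow> ('a \<Rightarrow> ereal) \<Rightarrow> 'a \<Rightarrow> real \<Rightarrow> ereal" where
  "amv_quotient M D f x r =
     ereal (1 / r\<^sup>2) * ereal_mean M (ball x r \<inter> D) (\<lambda>y. f y - f x)"

definition upper_amv_laplacian ::
    "'a::metric_space measure \<Rightarrow> 'a set \<Rightarrow> ('a \<Rightarrow> ereal) \<Rightarrow> 'a \<Rightarrow> ereal" where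
  "upper_amv_laplacian M D f x = Limsup (at_right 0) (amv_quotient M D f x)"

definition lower_amv_laplacian ::
    "'a::metric_space measure \<Rightarrow> 'a set \<Rightarrow> ('a \<Rightarrow> ereal) \<Rightarrow> 'a \<Rightarrow> ereal" where
  "lower_amv_laplacian M D f x = Liminf (at_right 0) (amv_quotient M D f x)"

end

theory Submission
  imports Defs
begin

text \<open>
  The proof perturbs the difference by the barrier and looks at a maximum point. Suppose
  \<open>u < v\<close> at some point of the closure. The function \<open>v - u + e * \<phi>\<close> is upper semicontinuous
  on the compact set \<^term>\<open>closure \<Omega>\<close>, so it attains its maximum there at some \<open>z\<close>
  (\<open>usc_on_attains_max\<close>). As \<open>\<phi>\<close> is bounded, for small \<open>e > 0\<close> the difference \<open>v - u\<close> is still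
  positive at \<open>z\<close>. Hence \<open>z\<close> is not on the boundary, and both \<open>u z\<close> and \<open>v z\<close> are finite.

  Maximality says that \<open>(v y - v z) + e * (\<phi> y - \<phi> z) \<le> u y - u z\<close> for all \<open>y\<close> in the closure.
  Averaging over a small ball around \<open>z\<close> turns this into the same inequality between the mean value
  quotients (\<open>amv_quotient_touching\<close>). In the limit \<open>r \<rightarrow> 0\<close> the quotient of \<open>\<phi>\<close> stays
  above a positive constant, so the quotients of \<open>u\<close> exceed those of \<open>v\<close> by a fixed positive
  amount for all small \<open>r\<close>. This contradicts the sign conditions, whether they
  are stated with the lower limits or with the upper limits (\<open>no_touching_point\<close>).

  The averaging step needs additivity of the integral, so the quotients must be honest real integrals
  over balls of finite measure. The measure need not be locally finite, but balls of infinite measure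
  give the quotient \<open>0\<close>; positivity of the lower Laplacian of \<open>\<phi>\<close> therefore forces the
  measure to be finite near every point of \<open>\<Omega>\<close>
  (\<open>emeasure_finite_if_amv_quotient_pos\<close>).
\<close>

section \<open>Semicontinuous functions\<close>

lemma usc_on_uminus:
  assumes "lsc_on S f"
  shows "usc_on S (\<lambda>x. - f x)"
  unfolding usc_on_def
proof (intro ballI conjI allI impI)
  fix x assume x: "x \<in> S"
  show "- f x < \<infinity>"
    using assms x by (cases "f x") (auto simp: lsc_on_def)
  fix c assume "- f x < c"
  then have "- c < f x"
    by (simp add: ereal_uminus_less_reorder)
  then have "\<forall>\<^sub>F y in at x within S. - c < f y"
    using assms x by (auto simp: lsc_on_def)
  then show "\<forall>\<^sub>F y in at x within S. - f y < c"
    by (simp add: ereal_uminus_less_reorder)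
qed

text \<open>
  The bound \<open>f + g < c\<close> persists nearby because it can be split at \<open>x\<close> into \<open>f < a\<close> and
  \<open>g < c - a\<close> with a real number \<open>a\<close>. Such an \<open>a\<close> exists even where \<open>f\<close> or \<open>g\<close> is \<open>-\<infinity>\<close>,
  since the value \<open>\<infinity>\<close> is excluded.
\<close>

lemma usc_on_add:
  assumes f: "usc_on S f" and g: "usc_on S g"
  shows "usc_on S (\<lambda>x. f x + g x)"
  unfolding usc_on_def
proof (intro ballI conjI allI impI)
  fix x assume x: "x \<in> S"
  have fin: "f x < \<infinity>" "g x < \<infinity>"
    using f g x by (auto simp: usc_on_def)
  then show "f x + g x < \<infinity>" by simp
  fix c assume less: "f x + g x < c"
  have "f x < c - g x"
    using less fin by (cases "f x"; cases "g x"; cases c) auto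
  then obtain a where a: "f x < ereal a" "ereal a < c - g x"
    using ereal_dense2 by blast
  have "g x < c - ereal a"
    using a(2) fin less by (cases "g x"; cases c) auto
  then have "\<forall>\<^sub>F y in at x within S. g y < c - ereal a"
    using g x by (auto simp: usc_on_def)
  moreover have "\<forall>\<^sub>F y in at x within S. f y < ereal a"
    using f x a(1) by (auto simp: usc_on_def)
  ultimately show "\<forall>\<^sub>F y in at x within S. f y + g y < c"
  proof eventually_elim
    case (elim y)
    then show ?case
      by (cases "f y"; cases "g y"; cases c) auto
  qed
qed

lemma usc_on_cmult:
  assumes f: "usc_on S (\<lambda>x. ereal (f x))" and "0 < e"
  shows "usc_on S (\<lambda>x. ereal (e * f x))"
  unfolding usc_on_def
proof (intro ballI conjI allI impI)
  fix x assume x: "x \<in> S"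
  show "ereal (e * f x) < \<infinity>" by simp
  have scale: "ereal (e * t) < c \<longleftrightarrow> ereal t < c / ereal e" for t c
    using \<open>0 < e\<close> by (cases c) (auto simp: field_simps)
  fix c assume "ereal (e * f x) < c"
  then show "\<forall>\<^sub>F y in at x within S. ereal (e * f y) < c"
    using f x unfolding scale usc_on_def by blast
qed

lemma usc_on_sublevel_openin:
  assumes "usc_on S f"
  shows "\<exists>T. open T \<and> {x\<in>S. f x < c} = S \<inter> T"
proof -
  have "\<exists>T. open T \<and> x \<in> T \<and> (\<forall>y\<in>S \<inter> T. f y < c)" if "x \<in> S" "f x < c" for x
  proof -
    from assms that have "\<forall>\<^sub>F y in at x within S. f y < c"
      by (auto simp: usc_on_def)
    with that(2) show ?thesis
      unfolding eventually_at_topological by (metis IntE)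
  qed
  then obtain T where T: "\<And>x. x \<in> S \<Longrightarrow> f x < c \<Longrightarrow> open (T x) \<and> x \<in> T x \<and> (\<forall>y\<in>S \<inter> T x. f y < c)"
    by metis
  show ?thesis
    by (rule exI[of _ "\<Union>x\<in>{x\<in>S. f x < c}. T x"]) (use T in blast)
qed

text \<open>
  Without a maximum, every point of \<open>K\<close> would lie in a sublevel set \<open>{x. f x < f z}\<close> for some
  \<open>z\<close> in \<open>K\<close>. By compactness finitely many such \<open>z\<close> suffice, but the one of them with the largest
  value lies in none of the chosen sets.
\<close>

lemma usc_on_attains_max:
  assumes "compact K" "K \<noteq> {}" and f: "usc_on K f"
  shows "\<exists>z\<in>K. \<forall>y\<in>K. f y \<le> f z"
proof (rule ccontr)
  assume "\<not> ?thesis"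
  then have nomax: "\<exists>z\<in>K. f y < f z" if "y \<in> K" for y
    using that by (meson not_le)
  obtain T where T: "\<And>c. open (T c)" "\<And>c. {x\<in>K. f x < c} = K \<inter> T c"
    using usc_on_sublevel_openin[OF f] by metis
  have "K \<subseteq> (\<Union>z\<in>K. T (f z))"
    using nomax T(2) by blast
  then obtain C where C: "C \<subseteq> K" "finite C" "K \<subseteq> (\<Union>z\<in>C. T (f z))"
    using compactE_image[OF \<open>compact K\<close>, of K "\<lambda>z. T (f z)"] T(1) by metis
  have "C \<noteq> {}"
    using C(3) \<open>K \<noteq> {}\<close> by auto
  then have "Max (f ` C) \<in> f ` C"
    using C(2) by (intro Max_in) auto
  then obtain m where m: "m \<in> C" "f m = Max (f ` C)" by auto
  then obtain z where z: "z \<in> C" "m \<in> T (f z)"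
    using C by blast
  then have "f m < f z"
    using T(2)[of "f z"] m(1) C(1) by blast
  moreover have "f z \<le> f m"
    using m z C(2) by simp
  ultimately show False by simp
qed

lemma usc_on_borel_measurable:
  assumes f: "usc_on S f" and B: "B \<subseteq> S" "B \<in> sets M" and M: "sets borel \<subseteq> sets M"
  shows "f \<in> borel_measurable (restrict_space M B)"
proof (rule borel_measurableI_less)
  fix c
  obtain T where "open T" and T: "{x\<in>S. f x < c} = S \<inter> T"
    using usc_on_sublevel_openin[OF f] by blast
  have *: "{x \<in> space (restrict_space M B). f x < c} = B \<inter> T"
    using T B sets.sets_into_space[OF B(2)] by (auto simp: space_restrict_space)
  have "T \<in> sets M"
    using M \<open>open T\<close> by auto
  then show "{x \<in> space (restrict_space M B). f x < c} \<in> sets (restrict_space M B)"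
    unfolding * sets_restrict_space by blast
qed

section \<open>Mean value quotients as real integrals\<close>

text \<open>
  Finiteness of the integral of \<open>\<bar>f\<bar>\<close> confines infinite values to a null set, which
  \<^const>\<open>real_of_ereal\<close> replaces by \<open>0\<close>. This makes linearity and monotonicity of the
  Lebesgue integral available. Finiteness of the measure of \<open>B\<close> enters so that the constant
  \<open>c\<close> is integrable.
\<close>

lemma ereal_integral_real:
  assumes B: "B \<in> sets M"
    and f: "f \<in> borel_measurable (restrict_space M B)"
    and int: "(\<integral>\<^sup>+y\<in>B. e2ennreal \<bar>f y\<bar> \<partial>M) < \<infinity>"
  shows "AE y in M. y \<in> B \<longrightarrow> \<bar>f y\<bar> \<noteq> \<infinity>"
    and "set_integrable M B (\<lambda>y. real_of_ereal (f y))"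
    and "emeasure M B < \<infinity> \<Longrightarrow>
      ereal_integral M B (\<lambda>y. f y - ereal c) = ereal (LINT y:B|M. real_of_ereal (f y) - c)"
proof -
  have BS: "B \<inter> space M \<in> sets M" using B by auto
  have meas: "(\<lambda>y. e2ennreal \<bar>f y\<bar> * indicator B y) \<in> borel_measurable M"
    using f BS by (subst borel_measurable_restrict_space_iff_ennreal[symmetric]) auto
  have "AE y in M. e2ennreal \<bar>f y\<bar> * indicator B y \<noteq> \<infinity>"
    using nn_integral_PInf_AE[OF meas] int by auto
  then show fin: "AE y in M. y \<in> B \<longrightarrow> \<bar>f y\<bar> \<noteq> \<infinity>"
    by eventually_elim (auto simp: e2ennreal_infty)
  have measF: "(\<lambda>y. indicator B y *\<^sub>R real_of_ereal (f y)) \<in> borel_measurable M"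
    using borel_measurable_real_of_ereal[OF f]
    unfolding borel_measurable_restrict_space_iff[OF BS] .
  have eq: "(\<integral>\<^sup>+y. ennreal (norm (indicator B y *\<^sub>R real_of_ereal (f y))) \<partial>M)
      = (\<integral>\<^sup>+y\<in>B. e2ennreal \<bar>f y\<bar> \<partial>M)"
  proof (rule nn_integral_cong_AE, use fin in eventually_elim)
    case (elim y)
    then show ?case
      by (cases "f y") (auto simp: indicator_def)
  qed
  show F: "set_integrable M B (\<lambda>y. real_of_ereal (f y))"
    unfolding set_integrable_def by (rule integrableI_bounded[OF measF]) (use eq int in simp)
  assume finite: "emeasure M B < \<infinity>"
  have "set_integrable M B (\<lambda>y. real_of_ereal (f y) - c)"
    by (intro set_integral_diff F) (use B finite in \<open>auto simp: set_integrable_def\<close>)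
  then have G: "integrable M (\<lambda>y. indicator B y *\<^sub>R (real_of_ereal (f y) - c))" (is "integrable M ?G")
    by (simp add: set_integrable_def)
  have pos: "(\<integral>\<^sup>+y\<in>B. e2ennreal (f y - ereal c) \<partial>M) = (\<integral>\<^sup>+y. ennreal (?G y) \<partial>M)"
  proof (rule nn_integral_cong_AE, use fin in eventually_elim)
    case (elim y)
    then show ?case
      by (cases "f y") (auto simp: indicator_def)
  qed
  have neg: "(\<integral>\<^sup>+y\<in>B. e2ennreal (- (f y - ereal c)) \<partial>M) = (\<integral>\<^sup>+y. ennreal (- ?G y) \<partial>M)"
  proof (rule nn_integral_cong_AE, use fin in eventually_elim)
    case (elim y)
    then show ?case
      by (cases "f y") (auto simp: indicator_def)
  qed
  have fins: "(\<integral>\<^sup>+y. ennreal (?G y) \<partial>M) \<noteq> \<infinity>" "(\<integral>\<^sup>+y. ennreal (- ?G y) \<partial>M) \<noteq> \<infinity>"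
    using G by (auto simp: real_integrable_def)
  have real: "enn2ereal a - enn2ereal b = ereal (enn2real a - enn2real b)"
    if "a \<noteq> \<infinity>" "b \<noteq> \<infinity>" for a b
    using that by (cases a; cases b) (auto simp: enn2ereal_ennreal)
  show "ereal_integral M B (\<lambda>y. f y - ereal c) = ereal (LINT y:B|M. real_of_ereal (f y) - c)"
    unfolding ereal_integral_def pos neg set_lebesgue_integral_def
    unfolding real_lebesgue_integral_def[OF G] by (rule real[OF fins])
qed

lemma amv_quotient_real:
  assumes B: "ball x r \<inter> D = B" "B \<in> sets M"
    and m: "0 < emeasure M B" "emeasure M B < \<infinity>"
    and f: "f \<in> borel_measurable (restrict_space M B)"
      "(\<integral>\<^sup>+y\<in>B. e2ennreal \<bar>f y\<bar> \<partial>M) < \<infinity>"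
    and fx: "f x = ereal c"
  shows "amv_quotient M D f x r =
    ereal (1 / r\<^sup>2 * ((LINT y:B|M. real_of_ereal (f y) - c) / measure M B))"
proof -
  have "enn2ereal (emeasure M B) = ereal (measure M B)"
    using m by (simp add: emeasure_eq_ennreal_measure enn2ereal_ennreal)
  moreover have "measure M B \<noteq> 0"
    using m by (metis emeasure_eq_ennreal_measure ennreal_0 infinity_ennreal_def less_irrefl)
  ultimately show ?thesis
    unfolding amv_quotient_def ereal_mean_def B(1) fx ereal_integral_real(3)[OF B(2) f m(2)]
    by simp
qed

text \<open>
  Dividing by \<open>\<infinity>\<close> gives \<open>0\<close> in the extended reals, even for \<open>\<infinity> / \<infinity>\<close>, so a nonzero
  quotient is only possible over a ball of finite measure.
\<close>

lemma emeasure_finite_if_amv_quotient_pos: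
  assumes "0 < amv_quotient M D f x r"
  shows "emeasure M (ball x r \<inter> D) < \<infinity>"
proof (rule ccontr)
  assume "\<not> ?thesis"
  then have "emeasure M (ball x r \<inter> D) = \<infinity>"
    by (simp add: less_top[symmetric])
  then have "ereal_mean M (ball x r \<inter> D) g = 0" for g
    by (simp add: ereal_mean_def divide_ereal_def)
  then show False
    using assms by (simp add: amv_quotient_def)
qed

text \<open>
  Where \<open>u\<close> and \<open>v\<close> are finite, that is, at \<open>z\<close> and at almost every point of \<open>B\<close>, the
  hypothesis \<open>max\<close> compares increments:
  \<open>(v y - v z) + e * (\<phi> y - \<phi> z) \<le> u y - u z\<close>. Integrating this real inequality over
  \<open>B\<close> gives the claim.
\<close>

lemma amv_quotient_touching:
  assumes B: "ball z r \<inter> D = B" "B \<in> sets M"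
    and m: "0 < emeasure M B" "emeasure M B < \<infinity>"
    and u: "u \<in> borel_measurable (restrict_space M B)"
      "(\<integral>\<^sup>+y\<in>B. e2ennreal \<bar>u y\<bar> \<partial>M) < \<infinity>" "\<bar>u z\<bar> \<noteq> \<infinity>"
    and v: "v \<in> borel_measurable (restrict_space M B)"
      "(\<integral>\<^sup>+y\<in>B. e2ennreal \<bar>v y\<bar> \<partial>M) < \<infinity>" "\<bar>v z\<bar> \<noteq> \<infinity>"
    and p: "(\<lambda>y. ereal (\<phi> y)) \<in> borel_measurable (restrict_space M B)"
      "(\<integral>\<^sup>+y\<in>B. e2ennreal \<bar>ereal (\<phi> y)\<bar> \<partial>M) < \<infinity>"
    and max: "\<And>y. y \<in> B \<Longrightarrow> v y - u y + ereal (e * \<phi> y) \<le> v z - u z + ereal (e * \<phi> z)"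
  shows "amv_quotient M D v z r + ereal e * amv_quotient M D (\<lambda>y. ereal (\<phi> y)) z r
    \<le> amv_quotient M D u z r"
proof -
  obtain a b where a: "u z = ereal a" and b: "v z = ereal b"
    using u(3) v(3) by auto
  let ?U = "\<lambda>y. real_of_ereal (u y) - a" and ?V = "\<lambda>y. real_of_ereal (v y) - b"
    and ?P = "\<lambda>y. real_of_ereal (ereal (\<phi> y)) - \<phi> z"
  note U = ereal_integral_real[OF B(2) u(1,2)]
  note V = ereal_integral_real[OF B(2) v(1,2)]
  note P = ereal_integral_real[OF B(2) p]
  have const: "set_integrable M B (\<lambda>_. t)" for t :: real
    using B(2) m(2) by (auto simp: set_integrable_def)
  have iU: "set_integrable M B ?U" and iV: "set_integrable M B ?V" and iP: "set_integrable M B ?P"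
    by (intro set_integral_diff const U(2) V(2) P(2))+
  have ieP: "set_integrable M B (\<lambda>y. e * ?P y)"
    using iP by simp
  have "(LINT y:B|M. ?V y) + e * (LINT y:B|M. ?P y) = (LINT y:B|M. ?V y + e * ?P y)"
    by (simp only: set_integral_add(2)[OF iV ieP] set_integral_mult_right)
  also have "\<dots> \<le> (LINT y:B|M. ?U y)"
  proof (rule set_integral_mono_AE[OF set_integral_add(1)[OF iV ieP] iU])
    show "AE y\<in>B in M. ?V y + e * ?P y \<le> ?U y"
      using U(1) V(1)
    proof eventually_elim
      case (elim y)
      show ?case
      proof
        assume y: "y \<in> B"
        then obtain s t where "u y = ereal s" "v y = ereal t"
          using elim by auto
        then show "?V y + e * ?P y \<le> ?U y"
          using max[OF y] a b by (simp add: algebra_simps)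
      qed
    qed
  qed
  finally have le: "(LINT y:B|M. ?V y) + e * (LINT y:B|M. ?P y) \<le> (LINT y:B|M. ?U y)" .
  have *: "1 / r\<^sup>2 * (i / measure M B) + e * (1 / r\<^sup>2 * (j / measure M B)) =
      1 / r\<^sup>2 * ((i + e * j) / measure M B)" for i j
    by (simp add: add_divide_distrib algebra_simps)
  show ?thesis
    unfolding amv_quotient_real[OF B m u(1,2) a] amv_quotient_real[OF B m v(1,2) b]
      amv_quotient_real[OF B m p refl] times_ereal.simps plus_ereal.simps ereal_less_eq *
    by (intro mult_left_mono divide_right_mono le) auto
qed

section \<open>The comparison principle\<close>

text \<open>
  Near \<open>z\<close> the quotients of \<open>u\<close> exceed those of \<open>v\<close> by \<open>d = e * c\<close>, where \<open>c > 0\<close> is a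
  lower bound for the quotients of \<open>\<phi>\<close>. Since \<open>d\<close> is constant, this gap passes to
  lower limits and to upper limits alike. It cannot be bridged when the limit for \<open>u\<close> is at most
  \<open>0\<close> and the corresponding limit for \<open>v\<close> is at least \<open>0\<close>. A positive
  lower Laplacian of \<open>\<phi>\<close> provides \<open>c\<close> at all small radii, so the gap is there along the
  radii that realise either limit.
\<close>

lemma no_touching_point:
  fixes M :: "'a::metric_space measure" and \<phi> :: "'a \<Rightarrow> real"
  assumes M: "metric_measure_space M"
    and proper: "\<And>S :: 'a set. closed S \<Longrightarrow> bounded S \<Longrightarrow> compact S"
    and \<Omega>: "open \<Omega>" "z \<in> \<Omega>"
    and u: "L1_loc M \<Omega> u" "\<bar>u z\<bar> \<noteq> \<infinity>"
    and v: "L1_loc M \<Omega> v" "\<bar>v z\<bar> \<noteq> \<infinity>"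
    and lap: "lower_amv_laplacian M (closure \<Omega>) u z \<le> 0 \<and>
              0 \<le> lower_amv_laplacian M (closure \<Omega>) v z \<or>
              upper_amv_laplacian M (closure \<Omega>) u z \<le> 0 \<and>
              0 \<le> upper_amv_laplacian M (closure \<Omega>) v z"
    and p: "bounded (\<phi> ` closure \<Omega>)" "usc_on (closure \<Omega>) (\<lambda>x. ereal (\<phi> x))"
      "0 < lower_amv_laplacian M (closure \<Omega>) (\<lambda>x. ereal (\<phi> x)) z"
    and "0 < e"
    and max: "\<And>y. y \<in> \<Omega> \<Longrightarrow> v y - u y + ereal (e * \<phi> y) \<le> v z - u z + ereal (e * \<phi> z)"
  shows False
proof -
  let ?Q = "amv_quotient M (closure \<Omega>)"
  let ?\<phi> = "\<lambda>x. ereal (\<phi> x)"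
  from p(3) obtain c where c: "0 < ereal c" "ereal c < lower_amv_laplacian M (closure \<Omega>) ?\<phi> z"
    using ereal_dense2 by blast
  have phi: "\<forall>\<^sub>F r in at_right 0. ereal c < ?Q ?\<phi> z r"
    using less_LiminfD[OF c(2)[unfolded lower_amv_laplacian_def]] .
  obtain R where R: "0 < R" "cball z R \<subseteq> \<Omega>"
    using \<Omega> open_contains_cball by blast
  have small: "\<forall>\<^sub>F r in at_right 0. 0 < r \<and> r < R"
    using R(1) by (auto intro: eventually_conj eventually_at_right_less eventually_at_rightI)
  have touch: "\<forall>\<^sub>F r in at_right 0. ?Q v z r + ereal (e * c) \<le> ?Q u z r"
    using phi small
  proof eventually_elim
    case (elim r)
    let ?B = "ball z r"
    have sub: "?B \<subseteq> cball z r" "cball z r \<subseteq> \<Omega>"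
      using R(2) elim(2) by auto
    have Beq: "?B \<inter> closure \<Omega> = ?B"
      using sub closure_subset by fastforce
    have B: "?B \<in> sets M"
      using M by (auto simp: metric_measure_space_def)
    have mpos: "0 < emeasure M ?B"
      using M elim(2) by (auto simp: metric_measure_space_def)
    \<comment> \<open>The barrier is what makes the ball of finite measure.\<close>
    have "0 < ?Q ?\<phi> z r"
      using c(1) elim(1) by (rule less_trans)
    from emeasure_finite_if_amv_quotient_pos[OF this] have mfin: "emeasure M ?B < \<infinity>"
      unfolding Beq .
    have cpt: "compact (cball z r)"
      by (rule proper[OF closed_cball bounded_cball])
    have loc: "f \<in> borel_measurable (restrict_space M ?B)
        \<and> (\<integral>\<^sup>+y\<in>?B. e2ennreal \<bar>f y\<bar> \<partial>M) < \<infinity>"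
      if "L1_loc M \<Omega> f" for f
    proof -
      have "(\<integral>\<^sup>+y\<in>cball z r. e2ennreal \<bar>f y\<bar> \<partial>M) < \<infinity>"
        using that sub(2) cpt by (auto simp: L1_loc_def)
      moreover have "(\<integral>\<^sup>+y\<in>?B. e2ennreal \<bar>f y\<bar> \<partial>M) \<le> (\<integral>\<^sup>+y\<in>cball z r. e2ennreal \<bar>f y\<bar> \<partial>M)"
        by (rule nn_integral_mono) (auto simp: indicator_def)
      moreover have "f \<in> borel_measurable (restrict_space (restrict_space M \<Omega>) ?B)"
        using that by (auto simp: L1_loc_def intro: measurable_restrict_space1)
      moreover have "restrict_space (restrict_space M \<Omega>) ?B = restrict_space M ?B"
      proof -
        have "\<Omega> \<inter> ?B = ?B" using sub by auto
        moreover have "\<Omega> \<inter> space M \<in> sets M"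
          using M \<Omega>(1) by (auto simp: metric_measure_space_def)
        ultimately show ?thesis
          using B by (subst restrict_restrict_space) auto
      qed
      ultimately show ?thesis by (auto intro: le_less_trans)
    qed
    have pm: "?\<phi> \<in> borel_measurable (restrict_space M ?B)"
      using M Beq by (intro usc_on_borel_measurable[OF p(2) _ B]) (auto simp: metric_measure_space_def)
    obtain K where K: "\<And>y. y \<in> closure \<Omega> \<Longrightarrow> \<bar>\<phi> y\<bar> \<le> K"
      using p(1) by (auto simp: bounded_iff)
    have "(\<integral>\<^sup>+y\<in>?B. e2ennreal \<bar>?\<phi> y\<bar> \<partial>M) \<le> (\<integral>\<^sup>+y\<in>?B. ennreal K \<partial>M)"
    proof (rule nn_integral_mono)
      fix y
      show "e2ennreal \<bar>?\<phi> y\<bar> * indicator ?B y \<le> ennreal K * indicator ?B y"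
      proof (cases "y \<in> ?B")
        case True
        then have "\<bar>\<phi> y\<bar> \<le> K" by (intro K) (use Beq in blast)
        with True show ?thesis by (simp add: ennreal_leI)
      qed simp
    qed
    also have "\<dots> < \<infinity>"
      using mfin B by (simp add: nn_integral_cmult_indicator ennreal_mult_less_top)
    finally have pi: "(\<integral>\<^sup>+y\<in>?B. e2ennreal \<bar>?\<phi> y\<bar> \<partial>M) < \<infinity>" .
    have "?Q v z r + ereal e * ?Q ?\<phi> z r \<le> ?Q u z r"
    proof (rule amv_quotient_touching[OF Beq B mpos mfin])
      show "v y - u y + ereal (e * \<phi> y) \<le> v z - u z + ereal (e * \<phi> z)" if "y \<in> ?B" for y
        using that sub by (intro max) auto
    qed (use loc[OF u(1)] loc[OF v(1)] u(2) v(2) pm pi in auto)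
    moreover have "ereal (e * c) \<le> ereal e * ?Q ?\<phi> z r"
      using elim(1) \<open>0 < e\<close> ereal_mult_left_mono[of "ereal c" "?Q ?\<phi> z r" "ereal e"] by simp
    ultimately show ?case
      using add_left_mono order_trans by blast
  qed
  define d where "d = e * c"
  have "0 < d" using \<open>0 < e\<close> c(1) by (simp add: d_def)
  then have half: "ereal (- d / 2) < 0" "0 < ereal (d / 2)" by simp_all
  note touch = touch[folded d_def]
  from lap show False
  proof
    assume low: "lower_amv_laplacian M (closure \<Omega>) u z \<le> 0 \<and>
      0 \<le> lower_amv_laplacian M (closure \<Omega>) v z"
    \<comment> \<open>Eventually the quotient of \<open>v\<close> is above \<open>- d / 2\<close>, hence that of \<open>u\<close> above \<open>d / 2\<close>.\<close>
    then have "ereal (- d / 2) < Liminf (at_right 0) (?Q v z)"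
      using less_le_trans[OF half(1)] unfolding lower_amv_laplacian_def by blast
    from less_LiminfD[OF this] touch have "\<forall>\<^sub>F r in at_right 0. ereal (d / 2) \<le> ?Q u z r"
    proof eventually_elim
      case (elim r)
      then show ?case
        by (cases "?Q v z r"; cases "?Q u z r") auto
    qed
    then have "ereal (d / 2) \<le> lower_amv_laplacian M (closure \<Omega>) u z"
      unfolding lower_amv_laplacian_def by (rule Liminf_bounded)
    with low have "ereal (d / 2) \<le> 0" by (meson order_trans)
    with \<open>0 < d\<close> show False by simp
  next
    assume up: "upper_amv_laplacian M (closure \<Omega>) u z \<le> 0 \<and>
      0 \<le> upper_amv_laplacian M (closure \<Omega>) v z"
    \<comment> \<open>Eventually the quotient of \<open>u\<close> is below \<open>d / 2\<close>, hence that of \<open>v\<close> below \<open>- d / 2\<close>.\<close>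
    then have "Limsup (at_right 0) (?Q u z) < ereal (d / 2)"
      using le_less_trans[OF _ half(2)] unfolding upper_amv_laplacian_def by blast
    from Limsup_lessD[OF this] touch have "\<forall>\<^sub>F r in at_right 0. ?Q v z r \<le> ereal (- d / 2)"
    proof eventually_elim
      case (elim r)
      then show ?case
        by (cases "?Q v z r"; cases "?Q u z r") auto
    qed
    then have "upper_amv_laplacian M (closure \<Omega>) v z \<le> ereal (- d / 2)"
      unfolding upper_amv_laplacian_def by (rule Limsup_bounded)
    with up have "0 \<le> ereal (- d / 2)" by (meson order_trans)
    with \<open>0 < d\<close> show False by simp
  qed
qed

theorem corollary4p8:
  fixes M :: "'a::metric_space measure"
    and \<Omega> :: "'a set"
    and u v :: "'a \<Rightarrow> ereal"
  assumes "metric_measure_space M"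
    and proper: "\<And>S :: 'a set. closed S \<Longrightarrow> bounded S \<Longrightarrow> compact S"
    and "open \<Omega>" and "bounded \<Omega>"
    and "L1_loc M \<Omega> u" and "precise_on M (closure \<Omega>) \<Omega> u" and "lsc_on (closure \<Omega>) u"
    and "L1_loc M \<Omega> v" and "precise_on M (closure \<Omega>) \<Omega> v" and "usc_on (closure \<Omega>) v"
    and boundary: "\<forall>x\<in>frontier \<Omega>. v x \<le> u x"
    and laplacian:
      "(\<forall>x\<in>\<Omega>. lower_amv_laplacian M (closure \<Omega>) u x \<le> 0 \<and>
              0 \<le> lower_amv_laplacian M (closure \<Omega>) v x) \<or>
       (\<forall>x\<in>\<Omega>. upper_amv_laplacian M (closure \<Omega>) u x \<le> 0 \<and>
              0 \<le> upper_amv_laplacian M (closure \<Omega>) v x)"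
    and barrier:
      "\<exists>\<phi> :: 'a \<Rightarrow> real. bounded (\<phi> ` closure \<Omega>) \<and>
         usc_on (closure \<Omega>) (\<lambda>x. ereal (\<phi> x)) \<and>
         (\<forall>x\<in>\<Omega>. 0 < lower_amv_laplacian M (closure \<Omega>) (\<lambda>x. ereal (\<phi> x)) x)"
  shows "\<forall>x\<in>closure \<Omega>. v x \<le> u x"
proof (rule ccontr)
  assume "\<not> ?thesis"
  then obtain x where x: "x \<in> closure \<Omega>" "u x < v x"
    by (auto simp: not_le)
  obtain \<phi> where \<phi>: "bounded (\<phi> ` closure \<Omega>)" "usc_on (closure \<Omega>) (\<lambda>x. ereal (\<phi> x))"
    "\<And>x. x \<in> \<Omega> \<Longrightarrow> 0 < lower_amv_laplacian M (closure \<Omega>) (\<lambda>x. ereal (\<phi> x)) x"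
    using barrier by blast
  obtain K where K: "0 < K" "\<And>y. y \<in> closure \<Omega> \<Longrightarrow> \<bar>\<phi> y\<bar> \<le> K"
    using \<phi>(1) by (auto simp: bounded_pos)
  have ufin: "- \<infinity> < u y" and vfin: "v y < \<infinity>" if "y \<in> closure \<Omega>" for y
    using that \<open>lsc_on (closure \<Omega>) u\<close> \<open>usc_on (closure \<Omega>) v\<close>
    by (auto simp: lsc_on_def usc_on_def)
  obtain a b where ab: "u x = ereal a" "v x = ereal b" "a < b"
    using x ufin[OF x(1)] vfin[OF x(1)] by (cases "u x"; cases "v x") auto
  \<comment> \<open>The perturbation \<open>e * \<phi>\<close> then oscillates by at most \<open>2 * e * K = (b - a) / 2\<close>, too little
    to offset the gap \<open>b - a\<close> at \<open>x\<close>; so \<open>v - u\<close> is still positive at the maximum point.\<close>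
  define e where "e = (b - a) / (4 * K)"
  have e: "0 < e" "4 * (e * K) = b - a"
    using K(1) ab(3) by (auto simp: e_def)
  define g where "g = (\<lambda>y. v y + - u y + ereal (e * \<phi> y))"
  have "usc_on (closure \<Omega>) g"
    unfolding g_def using assms \<phi>(2) e(1)
    by (intro usc_on_add usc_on_uminus usc_on_cmult) auto
  moreover have "compact (closure \<Omega>)"
    using \<open>bounded \<Omega>\<close> by (intro proper) auto
  ultimately obtain z where z: "z \<in> closure \<Omega>" "\<And>y. y \<in> closure \<Omega> \<Longrightarrow> g y \<le> g z"
    using usc_on_attains_max[of "closure \<Omega>" g] x(1) by (metis empty_iff)
  have osc: "\<bar>e * \<phi> y\<bar> \<le> e * K" if "y \<in> closure \<Omega>" for y
    using K(2)[OF that] e(1) by (simp add: abs_mult)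
  have "u z < v z" "\<bar>u z\<bar> \<noteq> \<infinity>" "\<bar>v z\<bar> \<noteq> \<infinity>"
    using z(2)[OF x(1)] ab e(2) osc[OF z(1)] osc[OF x(1)] ufin[OF z(1)] vfin[OF z(1)]
    unfolding g_def by (cases "u z"; cases "v z"; auto)+
  moreover from this have "z \<in> \<Omega>"
    using boundary z(1) \<open>open \<Omega>\<close> by (auto simp: frontier_def interior_open not_le[symmetric])
  ultimately show False
    using laplacian z(2) closure_subset[of \<Omega>] \<phi>(3)
    by (intro no_touching_point[OF \<open>metric_measure_space M\<close> proper \<open>open \<Omega>\<close> \<open>z \<in> \<Omega>\<close>
          \<open>L1_loc M \<Omega> u\<close> _ \<open>L1_loc M \<Omega> v\<close> _ _ \<phi>(1,2) _ e(1)])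
      (auto simp: g_def minus_ereal_def)
qed

end
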